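(* Let $\mathcal{M},\mathcal{N},\mathcal{S}$ be subspaces of $\mathcal{H}$ satisfying the idempotency condition, and let $E=P_{\mathcal{M},\mathcal{N},\mathcal{S}}$. Then $E$ is closed if and only if $\mathcal{M}$, $\mathcal{N}$, $\mathcal{S}$ and $\mathcal{M}^{\perp}+\mathcal{N}^{\perp}+\mathcal{S}^{\perp}$ are closed.
   Context: $\mathcal{H}$ is a complex separable Hilbert space; "subspace" means linear subspace, not necessarily closed. A linear relation on $\mathcal{H}$ is a linear subspace of $\mathcal{H}\times\mathcal{H}$; it is closed if it is a closed subspace of $\mathcal{H}\times\mathcal{H}$. For subspaces $\mathcal{M},\mathcal{N}$ of $\mathcal{H}$, $P_{\mathcal{M},\mathcal{N}}:=\{(m+n,m): m\in\mathcal{M},\ n\in\mathcal{N}\}$. Subspaces $\mathcal{M},\mathcal{N},\mathcal{S}$ satisfy the idempotency condition if $(\mathcal{M}+\mathcal{N})\cap\mathcal{S}=\mathcal{M}\cap\mathcal{N}$; in that case $P_{\mathcal{M},\mathcal{N},\mathcal{S}}:=P_{\mathcal{M},\mathcal{N}}\ \hat{+}\ (\{0\}\times\mathcal{S})=\{(m+n,m+s):m\in\mathcal{M},n\in\mathcal{N},s\in\mathcal{S}\}$, where $\hat{+}$ is the sum of subspaces of $\mathcal{H}\times\mathcal{H}$. $\mathcal{M}^\perp$ denotes the orthogonal complement in $\mathcal{H}$. *)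

theory Defs
  imports "HOL-Analysis.Analysis" "HOL-Library.Set_Algebras"
begin

section \<open>Complex Hilbert spaces\<close>

text \<open>
  The inner product is linear in its first argument and conjugate linear in its second.
  The norm, and with it the topology, is the one induced by the inner product.
\<close>

class complex_inner = real_normed_vector +
  fixes scaleC :: "complex \<Rightarrow> 'a \<Rightarrow> 'a"  (infixr "*\<^sub>C" 75)
    and cinner :: "'a \<Rightarrow> 'a \<Rightarrow> complex"
  assumes scaleC_add_right: "a *\<^sub>C (x + y) = a *\<^sub>C x + a *\<^sub>C y"
    and scaleC_add_left: "(a + b) *\<^sub>C x = a *\<^sub>C x + b *\<^sub>C x"
    and scaleC_scaleC: "a *\<^sub>C b *\<^sub>C x = (a * b) *\<^sub>C x"
    and scaleC_one: "1 *\<^sub>C x = x"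
    and scaleR_scaleC: "r *\<^sub>R x = complex_of_real r *\<^sub>C x"
    and cinner_commute: "cinner x y = cnj (cinner y x)"
    and cinner_add_left: "cinner (x + y) z = cinner x z + cinner y z"
    and cinner_scaleC_left: "cinner (a *\<^sub>C x) y = a * cinner x y"
    and cinner_self: "cinner x x = complex_of_real ((norm x)\<^sup>2)"

class complex_hilbert_space = complex_inner + complete_space

text \<open>Linear subspaces are over the complex scalars and are not required to be closed.\<close>

global_interpretation complex_vector:
  vector_space "scaleC :: complex \<Rightarrow> 'a \<Rightarrow> 'a::complex_inner"
  defines csubspace = complex_vector.subspace
  by unfold_locales
    (simp_all add: scaleC_add_right scaleC_add_left scaleC_scaleC scaleC_one)

definition orthogonal_complement :: "'a::complex_inner set \<Rightarrow> 'a set"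
  where "orthogonal_complement M = {x. \<forall>y\<in>M. cinner x y = 0}"

instantiation complex :: complex_hilbert_space
begin

definition scaleC_complex :: "complex \<Rightarrow> complex \<Rightarrow> complex"
  where "scaleC_complex a x = a * x"

definition cinner_complex :: "complex \<Rightarrow> complex \<Rightarrow> complex"
  where "cinner_complex x y = x * cnj y"

instance
proof
  fix x y :: complex
  show "cinner x x = complex_of_real ((norm x)\<^sup>2)"
    by (simp add: cinner_complex_def complex_norm_square del: of_real_power)
qed (simp_all add: scaleC_complex_def cinner_complex_def algebra_simps scaleR_conv_of_real)

end

text \<open>The product of two Hilbert spaces, with the product topology of the library.\<close>

instantiation prod :: (complex_inner, complex_inner) complex_inner
begin

definition scaleC_prod :: "complex \<Rightarrow> 'a \<times> 'b \<Rightarrow> 'a \<times> 'b"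
  where "scaleC_prod a p = (a *\<^sub>C fst p, a *\<^sub>C snd p)"

definition cinner_prod :: "'a \<times> 'b \<Rightarrow> 'a \<times> 'b \<Rightarrow> complex"
  where "cinner_prod p q = cinner (fst p) (fst q) + cinner (snd p) (snd q)"

instance
proof
  fix p q :: "'a \<times> 'b"
  show "cinner p q = cnj (cinner q p)"
    unfolding cinner_prod_def complex_cnj_add by (intro arg_cong2[where f="(+)"] cinner_commute)
  show "cinner p p = complex_of_real ((norm p)\<^sup>2)"
    by (simp add: cinner_prod_def cinner_self norm_prod_def)
qed (simp_all add: scaleC_prod_def cinner_prod_def scaleC_add_right scaleC_add_left
    scaleC_scaleC scaleC_one scaleR_scaleC cinner_add_left cinner_scaleC_left
    algebra_simps prod_eq_iff)

end

instance prod :: (complex_hilbert_space, complex_hilbert_space) complex_hilbert_space ..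


section \<open>Idempotent linear relations\<close>

type_synonym 'a relation = "('a \<times> 'a) set"

text \<open>The first component of a pair is the argument and the second one a value.
  The sum of sets is the elementwise sum of \<^theory>\<open>HOL-Library.Set_Algebras\<close>.\<close>

definition P2 :: "'a::complex_inner set \<Rightarrow> 'a set \<Rightarrow> 'a relation"
  where "P2 M N = {(m + n, m) | m n. m \<in> M \<and> n \<in> N}"

definition idempotency_condition ::
    "'a::complex_inner set \<Rightarrow> 'a set \<Rightarrow> 'a set \<Rightarrow> bool"
  where "idempotency_condition M N S \<longleftrightarrow> (M + N) \<inter> S = M \<inter> N"

definition P3 :: "'a::complex_inner set \<Rightarrow> 'a set \<Rightarrow> 'a set \<Rightarrow> 'a relation"
  where "P3 M N S = P2 M N + ({0} \<times> S)"

lemma P3_memI: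
  assumes "m \<in> M" "n \<in> N" "s \<in> S"
  shows "(m + n, m + s) \<in> P3 M N S"
proof -
  have "(m + n, m) \<in> P2 M N" and "(0, s) \<in> {0} \<times> S"
    using assms unfolding P2_def by auto
  then have "(m + n, m) + (0, s) \<in> P2 M N + {0} \<times> S"
    by (rule set_plus_intro)
  then show ?thesis
    by (simp add: P3_def)
qed

lemma P3_memE:
  assumes "p \<in> P3 M N S"
  obtains m n s where "m \<in> M" "n \<in> N" "s \<in> S" "p = (m + n, m + s)"
proof -
  from assms obtain a b where "a \<in> P2 M N" "b \<in> {0} \<times> S" and p: "p = a + b"
    unfolding P3_def by (rule set_plus_elim)
  then obtain m n s where mem: "m \<in> M" "n \<in> N" "s \<in> S" and "a = (m + n, m)" "b = (0, s)"
    unfolding P2_def by auto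
  with p have "p = (m + n, m + s)"
    by simp
  with mem show thesis
    by (rule that)
qed

lemma P3_eq: "P3 M N S = {(m + n, m + s) | m n s. m \<in> M \<and> n \<in> N \<and> s \<in> S}"
proof (intro subset_antisym subsetI)
  fix p assume "p \<in> P3 M N S"
  then show "p \<in> {(m + n, m + s) | m n s. m \<in> M \<and> n \<in> N \<and> s \<in> S}"
    by (rule P3_memE) (intro CollectI exI conjI)
next
  fix p assume "p \<in> {(m + n, m + s) | m n s. m \<in> M \<and> n \<in> N \<and> s \<in> S}"
  then show "p \<in> P3 M N S"
    by (elim CollectE exE conjE) (simp add: P3_memI)
qed

lemma csubspace_P3:
  assumes M: "csubspace M" and N: "csubspace N" and S: "csubspace S"
  shows "csubspace (P3 M N S)"
proof (rule complex_vector.subspaceI)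
  have "(0 + 0, 0 + 0) \<in> P3 M N S"
    by (intro P3_memI complex_vector.subspace_0 assms)
  then show "0 \<in> P3 M N S"
    by (simp add: zero_prod_def)
next
  fix p q assume "p \<in> P3 M N S" and q: "q \<in> P3 M N S"
  then obtain m n s where mem: "m \<in> M" "n \<in> N" "s \<in> S" and p_eq: "p = (m + n, m + s)"
    by (elim P3_memE)
  from q obtain m' n' s' where
    mem': "m' \<in> M" "n' \<in> N" "s' \<in> S" and q_eq: "q = (m' + n', m' + s')"
    by (elim P3_memE)
  have "p + q = ((m + m') + (n + n'), (m + m') + (s + s'))"
    by (simp add: p_eq q_eq)
  then show "p + q \<in> P3 M N S"
    by (simp only:) (intro P3_memI complex_vector.subspace_add assms mem mem')
next
  fix c p assume "p \<in> P3 M N S"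
  then obtain m n s where mem: "m \<in> M" "n \<in> N" "s \<in> S" and p_eq: "p = (m + n, m + s)"
    by (elim P3_memE)
  have "c *\<^sub>C p = (c *\<^sub>C m + c *\<^sub>C n, c *\<^sub>C m + c *\<^sub>C s)"
    by (simp add: p_eq scaleC_prod_def scaleC_add_right)
  then show "c *\<^sub>C p \<in> P3 M N S"
    by (simp only:) (intro P3_memI complex_vector.subspace_scale assms mem)
qed

end

(* E is the sum of A = {(x, x). x \<in> M} and B = N \<times> S, and A, B are closed if M, N, S are.
   A sum of two closed subspaces is closed iff the sum of their orthogonal complements is, and
   (x, y) belongs to the sum of the complements of A and B iff x + y lies in the sum of the
   complements of M, N, S. Conversely, the idempotency condition makes N, S and M the kernel, the
   multivalued part and the fixed point set of E, which are closed if E is. *)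

theory Submission
  imports Defs
begin

section \<open>Inner products\<close>

lemma cinner_zero_left [simp]: "cinner 0 y = 0"
  using cinner_add_left[of 0 0 y] by simp

lemma cinner_minus_left: "cinner (- x) y = - cinner x y"
  using cinner_add_left[of x "- x" y] by (simp add: add_eq_0_iff)

lemma cinner_diff_left: "cinner (x - y) z = cinner x z - cinner y z"
  using cinner_add_left[of x "- y" z] by (simp add: cinner_minus_left)

lemma cinner_add_right: "cinner x (y + z) = cinner x y + cinner x z"
  by (metis cinner_commute cinner_add_left complex_cnj_add)

lemma cinner_diff_right: "cinner x (y - z) = cinner x y - cinner x z"
  by (metis cinner_commute cinner_diff_left complex_cnj_diff)

lemma cinner_zero_right [simp]: "cinner x 0 = 0"
  using cinner_diff_right[of x 0 0] by simp

lemma cinner_scaleC_right: "cinner x (a *\<^sub>C y) = cnj a * cinner x y"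
  by (metis cinner_commute cinner_scaleC_left complex_cnj_mult)

lemma cinner_scaleR_left: "cinner (r *\<^sub>R x) y = r *\<^sub>R cinner x y"
  by (simp add: scaleR_scaleC[of r x] cinner_scaleC_left scaleR_conv_of_real)

lemma cinner_scaleR_right: "cinner x (r *\<^sub>R y) = r *\<^sub>R cinner x y"
  by (simp add: scaleR_scaleC[of r y] cinner_scaleC_right scaleR_conv_of_real)

lemma power2_norm_eq_cinner: "(norm x)\<^sup>2 = Re (cinner x x)"
  by (simp add: cinner_self del: of_real_power)

lemma parallelogram_law:
  fixes x y :: "'a::complex_inner"
  shows "(norm (x + y))\<^sup>2 + (norm (x - y))\<^sup>2 = 2 * (norm x)\<^sup>2 + 2 * (norm y)\<^sup>2"
  by (simp add: power2_norm_eq_cinner cinner_add_left cinner_add_right cinner_diff_left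
      cinner_diff_right)

text \<open>Pythagoras: the subtracted vector is the orthogonal projection of \<open>x\<close> onto
  the line spanned by \<open>y\<close>. This gives the Cauchy-Schwarz inequality and, later, the
  orthogonality at a nearest point.\<close>

lemma norm_diff_component:
  fixes x y :: "'a::complex_inner"
  assumes "y \<noteq> 0"
  shows "(norm (x - (cinner x y / (norm y)\<^sup>2) *\<^sub>C y))\<^sup>2
    = (norm x)\<^sup>2 - (cmod (cinner x y))\<^sup>2 / (norm y)\<^sup>2"
proof -
  let ?w = "cinner x y" and ?c = "cinner x y / (norm y)\<^sup>2"
  have n: "norm y \<noteq> 0"
    using assms by simp
  have "cinner (x - ?c *\<^sub>C y) (x - ?c *\<^sub>C y)
      = cinner x x - cnj ?c * ?w - ?c * cnj ?w + ?c * cnj ?c * cinner y y"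
    by (simp add: cinner_diff_left cinner_diff_right cinner_scaleC_left cinner_scaleC_right
        cinner_commute[of y x] algebra_simps)
  also have "\<dots> = cinner x x - ?w * cnj ?w / (norm y)\<^sup>2"
    using n by (simp add: cinner_self field_simps power2_eq_square)
  also have "\<dots> = complex_of_real ((norm x)\<^sup>2 - (cmod ?w)\<^sup>2 / (norm y)\<^sup>2)"
    by (simp add: cinner_self complex_norm_square[symmetric] del: of_real_power)
  finally show ?thesis
    by (metis cinner_self of_real_eq_iff)
qed

lemma Cauchy_Schwarz_cinner: "cmod (cinner x y) \<le> norm x * norm y"
proof (cases "y = 0")
  case False
  then have "0 \<le> (norm x)\<^sup>2 - (cmod (cinner x y))\<^sup>2 / (norm y)\<^sup>2"
    by (metis norm_diff_component zero_le_power2)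
  then have "(cmod (cinner x y))\<^sup>2 \<le> (norm x * norm y)\<^sup>2"
    using False by (simp add: field_simps)
  then show ?thesis
    by (rule power2_le_imp_le) simp
qed simp

lemma bounded_linear_cinner_left: "bounded_linear (\<lambda>x. cinner x y)"
  by (rule bounded_linear_intro[where K = "norm y"])
     (auto simp: cinner_add_left cinner_scaleR_left Cauchy_Schwarz_cinner)

lemmas continuous_on_cinner_left [continuous_intros] =
  bounded_linear.continuous_on[OF bounded_linear_cinner_left]


section \<open>Orthogonal complements\<close>

lemma csubspace_scaleR: "csubspace M \<Longrightarrow> x \<in> M \<Longrightarrow> r *\<^sub>R x \<in> M"
  by (simp add: scaleR_scaleC complex_vector.subspace_scale)

lemma csubspace_sum:
  assumes "csubspace A" and "csubspace B"
  shows "csubspace (A + B)"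
proof -
  have "A + B = {x + y | x y. x \<in> A \<and> y \<in> B}"
    by (auto simp: set_plus_def)
  then show ?thesis
    using complex_vector.subspace_sums[OF assms] by simp
qed

lemma csubspace_Times:
  assumes "csubspace A" and "csubspace B"
  shows "csubspace (A \<times> B)"
  using assms by (auto simp: complex_vector.subspace_def scaleC_prod_def zero_prod_def)

lemma subset_csubspace_sum:
  assumes "csubspace A" and "csubspace B"
  shows "A \<subseteq> A + B" and "B \<subseteq> A + B"
  using set_plus_intro[of _ A 0 B] set_plus_intro[of 0 A _ B]
    complex_vector.subspace_0[OF assms(1)] complex_vector.subspace_0[OF assms(2)] by auto

lemma orthogonal_complementD: "x \<in> orthogonal_complement M \<Longrightarrow> y \<in> M \<Longrightarrow> cinner x y = 0"
  by (simp add: orthogonal_complement_def)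

lemma orthogonal_complementD2: "x \<in> orthogonal_complement M \<Longrightarrow> y \<in> M \<Longrightarrow> cinner y x = 0"
  by (subst cinner_commute) (simp add: orthogonal_complement_def)

lemma orthogonal_complement_antimono:
  "M \<subseteq> N \<Longrightarrow> orthogonal_complement N \<subseteq> orthogonal_complement M"
  by (auto simp: orthogonal_complement_def)

lemma csubspace_orthogonal_complement: "csubspace (orthogonal_complement M)"
  by (auto simp: complex_vector.subspace_def orthogonal_complement_def cinner_add_left
      cinner_scaleC_left)

lemma closed_orthogonal_complement: "closed (orthogonal_complement M)"
proof -
  have "orthogonal_complement M = (\<Inter>y\<in>M. {x. cinner x y = 0})"
    by (auto simp: orthogonal_complement_def)
  then show ?thesis
    by (auto intro!: closed_INT closed_Collect_eq continuous_intros)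
qed

text \<open>Since both factors contain 0, the pairs \<open>(a, 0)\<close> and \<open>(0, b)\<close>
  test the two components separately.\<close>

lemma orthogonal_complement_Times:
  assumes "0 \<in> A" and "0 \<in> B"
  shows "orthogonal_complement (A \<times> B) = orthogonal_complement A \<times> orthogonal_complement B"
proof (intro subset_antisym subsetI)
  fix p assume p: "p \<in> orthogonal_complement (A \<times> B)"
  have "cinner (fst p) a = 0" if "a \<in> A" for a
    using orthogonal_complementD[OF p, of "(a, 0)"] that assms by (simp add: cinner_prod_def)
  moreover have "cinner (snd p) b = 0" if "b \<in> B" for b
    using orthogonal_complementD[OF p, of "(0, b)"] that assms by (simp add: cinner_prod_def)
  ultimately show "p \<in> orthogonal_complement A \<times> orthogonal_complement B"
    by (simp add: orthogonal_complement_def mem_Times_iff)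
qed (auto simp: orthogonal_complement_def cinner_prod_def)

text \<open>A minimizing sequence for the distance from \<open>x\<close> to \<open>Z\<close> is
  Cauchy by the parallelogram law. Its limit is a nearest point, and no move inside \<open>Z\<close>
  shortens the distance from there, which forces orthogonality.\<close>

lemma orthogonal_decomposition:
  fixes Z :: "'a::complex_hilbert_space set"
  assumes Z: "csubspace Z" and cl: "closed Z"
  obtains z where "z \<in> Z" and "x - z \<in> orthogonal_complement Z"
proof -
  define d where "d = (INF z\<in>Z. (norm (x - z))\<^sup>2)"
  have ne: "Z \<noteq> {}"
    using complex_vector.subspace_0[OF Z] by blast
  have bdd: "bdd_below ((\<lambda>z. (norm (x - z))\<^sup>2) ` Z)"
    by (rule bdd_belowI2[where m = 0]) simp
  have lower: "d \<le> (norm (x - z))\<^sup>2" if "z \<in> Z" for z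
    unfolding d_def by (rule cINF_lower[OF bdd that])
  have "\<exists>z\<in>Z. (norm (x - z))\<^sup>2 < d + 1 / real (Suc n)" for n
    using cINF_less_iff[OF ne bdd, of "d + 1 / real (Suc n)"] by (simp add: d_def)
  then obtain f where f: "\<And>n. f n \<in> Z" "\<And>n. (norm (x - f n))\<^sup>2 < d + 1 / real (Suc n)"
    by metis
  \<comment> \<open>The midpoint of \<open>f m\<close> and \<open>f n\<close> lies in
    \<open>Z\<close>, so its squared distance to \<open>x\<close> is at least \<open>d\<close>. The
    parallelogram law then cancels \<open>4 * d\<close> and leaves only the two error terms.\<close>
  have dist: "(norm (f m - f n))\<^sup>2 \<le> 2 / real (Suc m) + 2 / real (Suc n)" for m n
  proof -
    have "(1/2) *\<^sub>R (f m + f n) \<in> Z"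
      by (intro csubspace_scaleR[OF Z] complex_vector.subspace_add[OF Z] f)
    then have "4 * d \<le> 2\<^sup>2 * (norm (x - (1/2) *\<^sub>R (f m + f n)))\<^sup>2"
      using lower by simp
    also have "\<dots> = (norm (2 *\<^sub>R (x - (1/2) *\<^sub>R (f m + f n))))\<^sup>2"
      by (simp add: power_mult_distrib)
    also have "2 *\<^sub>R (x - (1/2) *\<^sub>R (f m + f n)) = (x - f m) + (x - f n)"
      by (simp add: scaleR_right_diff_distrib scaleR_2)
    finally have "4 * d \<le> (norm ((x - f m) + (x - f n)))\<^sup>2" .
    moreover have "norm ((x - f m) - (x - f n)) = norm (f m - f n)"
      by (simp add: norm_minus_commute)
    ultimately show ?thesis
      using parallelogram_law[of "x - f m" "x - f n"] f(2)[of m] f(2)[of n] by simp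
  qed
  have "Cauchy f"
  proof (rule CauchyI)
    fix e :: real assume "0 < e"
    \<comment> \<open>Beyond this threshold each of the two error terms in \<open>dist\<close> is
      below half of \<open>e\<close> squared.\<close>
    then obtain K where K: "4 / e\<^sup>2 < real K"
      using reals_Archimedean2 by blast
    have small: "2 / real (Suc k) < e\<^sup>2 / 2" if "K \<le> k" for k
    proof -
      have "4 / e\<^sup>2 < real (Suc k)"
        using K that by linarith
      then show ?thesis
        using \<open>0 < e\<close> by (simp add: field_simps)
    qed
    have "norm (f m - f n) < e" if "K \<le> m" "K \<le> n" for m n
    proof -
      have "(norm (f m - f n))\<^sup>2 < e\<^sup>2"
        using dist[of m n] small[OF that(1)] small[OF that(2)] by linarith
      then show ?thesis
        using \<open>0 < e\<close> by (simp add: power2_less_imp_less)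
    qed
    then show "\<exists>K. \<forall>m\<ge>K. \<forall>n\<ge>K. norm (f m - f n) < e"
      by blast
  qed
  then obtain z where z: "f \<longlonglongrightarrow> z"
    using Cauchy_convergent_iff convergent_def by blast
  have "z \<in> Z"
    using closed_sequentially[OF cl _ z] f by blast
  \<comment> \<open>The summand 0 is the limit of \<open>1 / real (Suc n)\<close>; it is kept so
    that the limit rule for sums applies literally.\<close>
  have "(norm (x - z))\<^sup>2 \<le> d + 0"
  proof (rule LIMSEQ_le)
    show "(\<lambda>n. (norm (x - f n))\<^sup>2) \<longlonglongrightarrow> (norm (x - z))\<^sup>2"
      by (intro tendsto_intros z)
    show "(\<lambda>n. d + 1 / real (Suc n)) \<longlonglongrightarrow> d + 0"
      using LIMSEQ_Suc[OF lim_1_over_n] by (intro tendsto_intros)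
  qed (use f less_imp_le in blast)
  then have min: "(norm (x - z))\<^sup>2 \<le> (norm (x - y))\<^sup>2" if "y \<in> Z" for y
    using lower[OF that] by linarith
  have "cinner (x - z) y = 0" if "y \<in> Z" for y
  proof (cases "y = 0")
    case False
    \<comment> \<open>The vector \<open>?c *\<^sub>C y\<close> is the projection of
      \<open>x - z\<close> onto the line of \<open>y\<close>. Moving \<open>z\<close> by it would
      shorten the distance unless the inner product vanishes.\<close>
    let ?c = "cinner (x - z) y / (norm y)\<^sup>2"
    have "z + ?c *\<^sub>C y \<in> Z"
      by (intro complex_vector.subspace_add[OF Z] complex_vector.subspace_scale[OF Z] that \<open>z \<in> Z\<close>)
    from min[OF this] have "(norm (x - z))\<^sup>2 \<le> (norm ((x - z) - ?c *\<^sub>C y))\<^sup>2"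
      by (simp add: algebra_simps)
    then have "(cmod (cinner (x - z) y))\<^sup>2 / (norm y)\<^sup>2 \<le> 0"
      by (simp only: norm_diff_component[OF False])
    then show ?thesis
      using False by (simp add: field_simps)
  qed simp
  with \<open>z \<in> Z\<close> show thesis
    by (intro that) (auto simp: orthogonal_complement_def)
qed

text \<open>If \<open>x\<close> is in the double complement and \<open>z\<close> is its projection
  onto \<open>Z\<close>, then \<open>x - z\<close> is orthogonal to both \<open>x\<close> and
  \<open>z\<close>, hence to itself, and so it is 0.\<close>

lemma orthogonal_complement_orthogonal_complement:
  fixes Z :: "'a::complex_hilbert_space set"
  assumes "csubspace Z" and "closed Z"
  shows "orthogonal_complement (orthogonal_complement Z) = Z"
proof (intro subset_antisym subsetI)
  fix x assume x: "x \<in> orthogonal_complement (orthogonal_complement Z)"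
  obtain z where z: "z \<in> Z" "x - z \<in> orthogonal_complement Z"
    using orthogonal_decomposition[OF assms] .
  then have "cinner (x - z) (x - z) = 0"
    using orthogonal_complementD[OF x, of "x - z"] orthogonal_complementD2[OF z(2,1)]
    by (simp add: cinner_diff_left)
  then have "x = z"
    by (simp add: cinner_self)
  with z show "x \<in> Z"
    by simp
next
  fix x assume "x \<in> Z"
  then have "cinner x y = 0" if "y \<in> orthogonal_complement Z" for y
    using orthogonal_complementD2[OF that] by blast
  then show "x \<in> orthogonal_complement (orthogonal_complement Z)"
    by (simp add: orthogonal_complement_def)
qed


section \<open>Closed sums\<close>

text \<open>The Banach-Steinhaus theorem for the functionals that the vectors of \<open>Q\<close>
  induce on \<open>Z\<close>, by a Baire argument in \<open>Z\<close>. As \<open>Q\<close> lies in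
  \<open>Z\<close>, bounding the functionals bounds the vectors themselves.\<close>

lemma uniform_boundedness_cinner:
  fixes Z :: "'a::complex_hilbert_space set"
  assumes Z: "csubspace Z" and cl: "closed Z" and "Q \<subseteq> Z"
    and pointwise: "\<And>z. z \<in> Z \<Longrightarrow> \<exists>K. \<forall>q\<in>Q. cmod (cinner z q) \<le> K"
  obtains C where "\<And>q. q \<in> Q \<Longrightarrow> norm q \<le> C"
proof -
  define F where "F n = {z\<in>Z. \<forall>q\<in>Q. cmod (cinner z q) \<le> real n}" for n
  have clF: "closed (F n)" for n
  proof -
    have "F n = Z \<inter> (\<Inter>q\<in>Q. {z. cmod (cinner z q) \<le> real n})"
      by (auto simp: F_def)
    then show ?thesis
      by (auto intro!: closed_INT closed_Collect_le closed_Int cl continuous_intros)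
  qed
  have "\<Union>(range F) = Z"
  proof (intro subset_antisym subsetI)
    fix z assume "z \<in> Z"
    then obtain K where K: "\<forall>q\<in>Q. cmod (cinner z q) \<le> K"
      using pointwise by blast
    obtain n where "K \<le> real n"
      using real_arch_simple by blast
    with K \<open>z \<in> Z\<close> have "z \<in> F n"
      by (fastforce simp: F_def)
    then show "z \<in> \<Union>(range F)"
      by blast
  qed (auto simp: F_def)
  moreover have "completely_metrizable_space (top_of_set Z)"
    using cl completely_metrizable_space_closedin completely_metrizable_space_euclidean
    by (metis closed_closedin)
  moreover have "closedin (top_of_set Z) (F n)" for n
    using clF by (auto intro!: closed_subset simp: F_def)
  \<comment> \<open>The closed sets \<open>F n\<close> exhaust \<open>Z\<close>, which is its own
    nonempty interior, so by Baire they cannot all have empty interior.\<close>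
  ultimately have "\<exists>n. top_of_set Z interior_of F n \<noteq> {}"
    using Baire_category_alt[of "top_of_set Z" "range F"] complex_vector.subspace_0[OF Z]
      interior_of_topspace[of "top_of_set Z"] by auto
  then obtain n z U where U: "openin (top_of_set Z) U" "z \<in> U" "U \<subseteq> F n"
    by (auto simp: interior_of_def)
  then obtain r where r: "r > 0" "ball z r \<inter> Z \<subseteq> U"
    by (meson openin_contains_ball)
  have z: "z \<in> F n" "z \<in> Z"
    using U by (auto simp: F_def)
  have "norm q \<le> 4 * real n / r" if "q \<in> Q" for q
  proof (cases "q = 0")
    case False
    \<comment> \<open>The multiple of \<open>q\<close> of norm \<open>r / 2\<close>:
      \<open>z + y\<close> stays in the ball, while \<open>cinner y q\<close> recovers the norm of
      \<open>q\<close>.\<close>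
    define y where "y = (r / (2 * norm q)) *\<^sub>R q"
    have "z + y \<in> Z"
      unfolding y_def using \<open>Q \<subseteq> Z\<close> that z
      by (intro complex_vector.subspace_add[OF Z] csubspace_scaleR[OF Z]) auto
    moreover have "z + y \<in> ball z r"
      using False r by (simp add: y_def dist_norm)
    ultimately have "z + y \<in> F n"
      using r U by blast
    with z that have "cmod (cinner (z + y) q) \<le> n" "cmod (cinner z q) \<le> n"
      by (auto simp: F_def)
    then have "cmod (cinner y q) \<le> 2 * n"
      using norm_triangle_ineq4[of "cinner (z + y) q" "cinner z q"]
      by (simp add: cinner_add_left)
    moreover have "cmod (cinner y q) = r * norm q / 2"
      using False r by (simp add: y_def cinner_scaleR_left cinner_self norm_mult power2_eq_square)
    ultimately show ?thesis
      using r by (simp add: field_simps)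
  qed (use r in simp)
  then show thesis
    by (rule that)
qed

text \<open>For \<open>q\<close> orthogonal to \<open>B\<close>, the product
  \<open>cinner (a + b) q\<close> depends only on \<open>a\<close>, so bounds on \<open>A\<close>
  give pointwise bounds on \<open>A + B\<close>. Closedness of the sum makes them uniform.\<close>

lemma norm_le_of_closed_sum:
  fixes A B :: "'a::complex_hilbert_space set"
  assumes A: "csubspace A" and B: "csubspace B" and cl: "closed (A + B)"
  obtains C where "C > 0"
    and "\<And>q t. q \<in> orthogonal_complement B \<Longrightarrow> q \<in> A + B \<Longrightarrow> t > 0 \<Longrightarrow>
      (\<And>a. a \<in> A \<Longrightarrow> cmod (cinner a q) \<le> t * norm a) \<Longrightarrow> norm q \<le> C * t"
proof -
  \<comment> \<open>The case \<open>t = 1\<close>; the general one follows by scaling with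
    \<open>1 / t\<close>.\<close>
  define Q where
    "Q = {q \<in> orthogonal_complement B \<inter> (A + B). \<forall>a\<in>A. cmod (cinner a q) \<le> norm a}"
  note AB = csubspace_sum[OF A B]
  have Q_sub: "Q \<subseteq> A + B"
    by (auto simp: Q_def)
  have "\<exists>K. \<forall>q\<in>Q. cmod (cinner z q) \<le> K" if z: "z \<in> A + B" for z
  proof -
    obtain a b where "a \<in> A" "b \<in> B" and "z = a + b"
      using z by (rule set_plus_elim)
    then have "cmod (cinner z q) \<le> norm a" if "q \<in> Q" for q
      using that by (auto simp: Q_def cinner_add_left orthogonal_complementD2)
    then show ?thesis
      by blast
  qed
  then obtain C where C: "\<And>q. q \<in> Q \<Longrightarrow> norm q \<le> C"
    using uniform_boundedness_cinner[OF AB cl, of Q] Q_sub by blast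
  show thesis
  proof (rule that)
    \<comment> \<open>Uniform boundedness does not guarantee a positive constant; the maximum with 1
      does.\<close>
    show "max C 1 > 0"
      by simp
  next
    fix q t
    assume q: "q \<in> orthogonal_complement B" "q \<in> A + B" and t: "(t::real) > 0"
      and le: "\<And>a. a \<in> A \<Longrightarrow> cmod (cinner a q) \<le> t * norm a"
    have "(1 / t) *\<^sub>R q \<in> Q"
      using q t le csubspace_scaleR[OF AB]
        csubspace_scaleR[OF csubspace_orthogonal_complement]
      by (auto simp: Q_def cinner_scaleR_right field_simps)
    then have "norm q \<le> C * t"
      using C t by (fastforce simp: field_simps)
    also have "\<dots> \<le> max C 1 * t"
      using t by (intro mult_right_mono) auto
    finally show "norm q \<le> max C 1 * t" .
  qed
qed

text \<open>Choosing the summands in the complement of \<open>B\<close> inside \<open>A + B\<close> makes them a Cauchy sequence: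
  by uniform boundedness such vectors are controlled by their inner products with \<open>A\<close>, which only
  see the convergent sequence of sums.\<close>

lemma closed_sum_orthogonal_complement:
  fixes A B :: "'a::complex_hilbert_space set"
  assumes A: "csubspace A" and B: "csubspace B" and cl: "closed (A + B)"
  shows "closed (orthogonal_complement A + orthogonal_complement B)"
  unfolding closed_sequential_limits
proof (intro allI impI, elim conjE)
  fix x l
  assume mem: "\<forall>n. x n \<in> orthogonal_complement A + orthogonal_complement B" and x: "x \<longlonglongrightarrow> l"
  note AB = csubspace_sum[OF A B]
  note sub = orthogonal_complement_antimono[OF subset_csubspace_sum(1)[OF A B]]
    orthogonal_complement_antimono[OF subset_csubspace_sum(2)[OF A B]]
  have "\<exists>r. r \<in> orthogonal_complement B \<and> r \<in> A + B \<and> x n - r \<in> orthogonal_complement A" for n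
  proof -
    have "x n \<in> orthogonal_complement A + orthogonal_complement B"
      using mem by blast
    then obtain p q where pq: "p \<in> orthogonal_complement A" "q \<in> orthogonal_complement B"
      and xn: "x n = p + q"
      by (rule set_plus_elim)
    \<comment> \<open>The part \<open>q - r\<close> discarded by the projection is orthogonal to
      both \<open>A\<close> and \<open>B\<close>. It can therefore be moved from the second summand
      to the first.\<close>
    obtain r where r: "r \<in> A + B" "q - r \<in> orthogonal_complement (A + B)"
      using orthogonal_decomposition[OF AB cl] .
    have "q - (q - r) \<in> orthogonal_complement B"
      by (rule complex_vector.subspace_diff[OF csubspace_orthogonal_complement pq(2)])
         (use r sub in blast)
    moreover have "p + (q - r) \<in> orthogonal_complement A"
      by (rule complex_vector.subspace_add[OF csubspace_orthogonal_complement pq(1)])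
         (use r sub in blast)
    ultimately show ?thesis
      using r xn by (intro exI[of _ r]) (simp add: algebra_simps)
  qed
  then obtain r where r: "\<And>n. r n \<in> orthogonal_complement B" "\<And>n. r n \<in> A + B"
      "\<And>n. x n - r n \<in> orthogonal_complement A"
    by metis
  obtain C where "C > 0" and C: "\<And>q t. q \<in> orthogonal_complement B \<Longrightarrow> q \<in> A + B \<Longrightarrow> t > 0 \<Longrightarrow>
      (\<And>a. a \<in> A \<Longrightarrow> cmod (cinner a q) \<le> t * norm a) \<Longrightarrow> norm q \<le> C * t"
    using norm_le_of_closed_sum[OF A B cl] by blast
  have "Cauchy r"
  proof (rule CauchyI)
    fix e :: real assume "0 < e"
    \<comment> \<open>Chosen so that \<open>C * t\<close> is half of \<open>e\<close>.\<close>
    define t where "t = e / (2 * C)"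
    have "t > 0"
      using \<open>0 < e\<close> \<open>C > 0\<close> by (simp add: t_def)
    obtain K where K: "\<And>m n. m \<ge> K \<Longrightarrow> n \<ge> K \<Longrightarrow> norm (x m - x n) < t"
      using CauchyD[OF LIMSEQ_imp_Cauchy[OF x] \<open>t > 0\<close>] by blast
    have "norm (r m - r n) < e" if "m \<ge> K" "n \<ge> K" for m n
    proof -
      have "cmod (cinner a (r m - r n)) \<le> t * norm a" if "a \<in> A" for a
      proof -
        have "cinner a (x m - r m) = 0" "cinner a (x n - r n) = 0"
          using orthogonal_complementD2[OF r(3) that] by auto
        then have "cinner a (r m - r n) = cinner a (x m - x n)"
          by (simp add: cinner_diff_right)
        then have "cmod (cinner a (r m - r n)) \<le> norm a * norm (x m - x n)"
          by (simp add: Cauchy_Schwarz_cinner)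
        also have "\<dots> \<le> norm a * t"
          using K[OF \<open>m \<ge> K\<close> \<open>n \<ge> K\<close>] by (intro mult_left_mono) auto
        finally show ?thesis
          by (simp add: mult.commute)
      qed
      then have "norm (r m - r n) \<le> C * t"
        by (intro C complex_vector.subspace_diff csubspace_orthogonal_complement AB r \<open>t > 0\<close>)
      also have "\<dots> < e"
        using \<open>0 < e\<close> \<open>C > 0\<close> by (simp add: t_def)
      finally show ?thesis .
    qed
    then show "\<exists>K. \<forall>m\<ge>K. \<forall>n\<ge>K. norm (r m - r n) < e"
      by blast
  qed
  then obtain s where s: "r \<longlonglongrightarrow> s"
    using Cauchy_convergent_iff convergent_def by blast
  have "s \<in> orthogonal_complement B"
    using closed_sequentially[OF closed_orthogonal_complement _ s] r by blast
  moreover have "l - s \<in> orthogonal_complement A"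
    using closed_sequentially[OF closed_orthogonal_complement _ tendsto_diff[OF x s]] r by blast
  ultimately show "l \<in> orthogonal_complement A + orthogonal_complement B"
    using set_plus_intro[of "l - s" _ s] by fastforce
qed

text \<open>The converse is the forward implication applied to the complements, whose own
  complements are \<open>A\<close> and \<open>B\<close> again by closedness.\<close>

lemma closed_sum_iff_closed_sum_orthogonal_complement:
  fixes A B :: "'a::complex_hilbert_space set"
  assumes "csubspace A" "csubspace B" "closed A" "closed B"
  shows "closed (A + B) \<longleftrightarrow> closed (orthogonal_complement A + orthogonal_complement B)"
  using closed_sum_orthogonal_complement[OF assms(1,2)]
    closed_sum_orthogonal_complement[of "orthogonal_complement A" "orthogonal_complement B"]
  by (auto simp: csubspace_orthogonal_complement orthogonal_complement_orthogonal_complement assms)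


section \<open>Idempotent relations\<close>

text \<open>The splitting \<open>(m + n, m + s) = (m, m) + (n, s)\<close> turns closedness of the
  relation into a question about a sum of two subspaces.\<close>

lemma P3_eq_graph_plus_Times: "P3 M N S = {(x, x) | x. x \<in> M} + N \<times> S"
proof (intro subset_antisym subsetI)
  fix p assume "p \<in> P3 M N S"
  then obtain m n s where "m \<in> M" "n \<in> N" "s \<in> S" and p: "p = (m, m) + (n, s)"
    by (elim P3_memE) simp
  then show "p \<in> {(x, x) | x. x \<in> M} + N \<times> S"
    by blast
next
  fix p assume "p \<in> {(x, x) | x. x \<in> M} + N \<times> S"
  then show "p \<in> P3 M N S"
    by (elim set_plus_elim) (auto intro: P3_memI)
qed

text \<open>A vanishing value forces \<open>m = - s\<close>, so \<open>m\<close> lies in both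
  \<open>M + N\<close> and \<open>S\<close>, hence in \<open>N\<close>.\<close>

lemma P3_ker:
  assumes M: "csubspace M" and N: "csubspace N" and S: "csubspace S"
    and idem: "idempotency_condition M N S"
  shows "(x, 0) \<in> P3 M N S \<longleftrightarrow> x \<in> N"
proof
  assume "(x, 0) \<in> P3 M N S"
  then obtain m n s where mem: "m \<in> M" "n \<in> N" "s \<in> S" and eq: "x = m + n" "m + s = 0"
    by (elim P3_memE) auto
  then have "m \<in> S" "m \<in> M + N"
    using complex_vector.subspace_neg[OF S, of s] eq_neg_iff_add_eq_0[of m s] subset_csubspace_sum(1)[OF M N] by auto
  then have "m \<in> N"
    using idem by (auto simp: idempotency_condition_def)
  then show "x \<in> N"
    using mem eq complex_vector.subspace_add[OF N] by blast
qed (use P3_memI[of 0 M x N 0 S] complex_vector.subspace_0 M S in auto)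

text \<open>A vanishing argument forces \<open>m = - n\<close>, so \<open>m\<close> lies in both
  \<open>M\<close> and \<open>N\<close>, hence in \<open>S\<close>.\<close>

lemma P3_mul:
  assumes M: "csubspace M" and N: "csubspace N" and S: "csubspace S"
    and idem: "idempotency_condition M N S"
  shows "(0, y) \<in> P3 M N S \<longleftrightarrow> y \<in> S"
proof
  assume "(0, y) \<in> P3 M N S"
  then obtain m n s where mem: "m \<in> M" "n \<in> N" "s \<in> S" and eq: "y = m + s" "m + n = 0"
    by (elim P3_memE) auto
  then have "m \<in> M \<inter> N"
    using complex_vector.subspace_neg[OF N, of n] eq_neg_iff_add_eq_0[of m n] by auto
  then have "m \<in> S"
    using idem by (auto simp: idempotency_condition_def)
  then show "y \<in> S"
    using mem eq complex_vector.subspace_add[OF S] by blast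
qed (use P3_memI[of 0 M 0 N y S] complex_vector.subspace_0 M N in auto)

text \<open>Equal components force \<open>n = s\<close>, a vector in both \<open>M + N\<close> and
  \<open>S\<close>, hence in \<open>M\<close>.\<close>

lemma P3_fixed:
  assumes M: "csubspace M" and N: "csubspace N" and S: "csubspace S"
    and idem: "idempotency_condition M N S"
  shows "(x, x) \<in> P3 M N S \<longleftrightarrow> x \<in> M"
proof
  assume "(x, x) \<in> P3 M N S"
  then obtain m n where mem: "m \<in> M" "n \<in> N" "n \<in> S" and eq: "x = m + n"
    by (elim P3_memE) auto
  then have "n \<in> M"
    using idem subset_csubspace_sum(2)[OF M N] by (auto simp: idempotency_condition_def)
  then show "x \<in> M"
    using mem eq complex_vector.subspace_add[OF M] by blast
qed (use P3_memI[of x M 0 N 0 S] complex_vector.subspace_0 N S in auto)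

text \<open>A pair \<open>(u, v)\<close> is orthogonal to the diagonal over \<open>M\<close> iff
  \<open>u + v\<close> is orthogonal to \<open>M\<close>. Adding the complement of
  \<open>N \<times> S\<close> shifts \<open>u\<close> and \<open>v\<close> independently, so only
  the sum of the components matters.\<close>

lemma orthogonal_complement_graph_plus_Times:
  fixes M N S :: "'a::complex_inner set"
  assumes N: "csubspace N" and S: "csubspace S"
  shows "orthogonal_complement {(x, x) | x. x \<in> M} + orthogonal_complement (N \<times> S) =
    (\<lambda>p. fst p + snd p) -`
      (orthogonal_complement M + orthogonal_complement N + orthogonal_complement S)"
    (is "?L = ?R")
proof -
  have B: "orthogonal_complement (N \<times> S) = orthogonal_complement N \<times> orthogonal_complement S"
    by (intro orthogonal_complement_Times complex_vector.subspace_0 N S)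
  have A: "(u, v) \<in> orthogonal_complement {(x, x) | x. x \<in> M} \<longleftrightarrow> u + v \<in> orthogonal_complement M"
    for u v
    by (auto simp: orthogonal_complement_def cinner_prod_def cinner_add_left)
  show ?thesis
  proof (intro subset_antisym subsetI)
    fix p assume "p \<in> ?L"
    then obtain u v n s where "u + v \<in> orthogonal_complement M" "n \<in> orthogonal_complement N"
      "s \<in> orthogonal_complement S" and p: "p = (u, v) + (n, s)"
      unfolding B by (elim set_plus_elim) (auto simp: A)
    then have "(u + v) + n + s
        \<in> orthogonal_complement M + orthogonal_complement N + orthogonal_complement S"
      by (intro set_plus_intro)
    then show "p \<in> ?R"
      by (simp add: p algebra_simps)
  next
    fix p assume "p \<in> ?R"
    then obtain m n s where mem: "m \<in> orthogonal_complement M" "n \<in> orthogonal_complement N"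
      "s \<in> orthogonal_complement S" and p: "fst p + snd p = m + n + s"
      by (auto elim!: set_plus_elim)
    \<comment> \<open>Taking \<open>n\<close> off the first component and \<open>s\<close> off the
      second leaves a pair with sum \<open>m\<close>, which is orthogonal to the diagonal.\<close>
    have "fst p - n + (snd p - s) = m"
      using p by (simp add: algebra_simps)
    then have "(fst p - n, snd p - s) \<in> orthogonal_complement {(x, x) | x. x \<in> M}"
      using mem A by simp
    then have "(fst p - n, snd p - s) + (n, s) \<in> ?L"
      unfolding B using mem by (intro set_plus_intro) auto
    then show "p \<in> ?L"
      by simp
  qed
qed

text \<open>Addition is continuous and has the continuous right inverse sending \<open>x\<close> to
  \<open>(x, 0)\<close>, so closedness passes in both directions.\<close>

lemma closed_vimage_add_iff:
  fixes T :: "'a::real_normed_vector set"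
  shows "closed ((\<lambda>p. fst p + snd p) -` T) \<longleftrightarrow> closed T"
proof
  assume "closed ((\<lambda>p. fst p + snd p) -` T)"
  then have "closed ((\<lambda>x. (x, 0)) -` ((\<lambda>p. fst p + snd p) -` T))"
    by (rule closed_vimage) (intro continuous_intros)
  then show "closed T"
    by (simp add: vimage_def)
qed (intro closed_vimage continuous_intros)

theorem theorem5p7:
  fixes M N S :: "'a::complex_hilbert_space set"
    and E :: "'a relation"
  assumes "separable_space (euclidean :: 'a topology)"
    and "csubspace M" and "csubspace N" and "csubspace S"
    and "idempotency_condition M N S"
    and "E = P3 M N S"
  shows "closed E \<longleftrightarrow> closed M \<and> closed N \<and> closed S \<and>
    closed (orthogonal_complement M + orthogonal_complement N + orthogonal_complement S)"
proof -
  note [simp] = P3_fixed[OF assms(2-5)] P3_ker[OF assms(2-5)] P3_mul[OF assms(2-5)]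
  have "closed M \<and> closed N \<and> closed S" if "closed E"
  proof -
    \<comment> \<open>These preimages under continuous maps are the fixed point set, the kernel and
      the multivalued part, that is \<open>M\<close>, \<open>N\<close> and \<open>S\<close>.\<close>
    have "closed ((\<lambda>x. (x, x)) -` E)" "closed ((\<lambda>x. (x, 0)) -` E)" "closed ((\<lambda>y. (0, y)) -` E)"
      using that by (auto intro!: closed_vimage continuous_intros)
    then show ?thesis
      by (simp add: assms(6) vimage_def)
  qed
  moreover have "closed E \<longleftrightarrow>
      closed (orthogonal_complement M + orthogonal_complement N + orthogonal_complement S)"
    if cl: "closed M" "closed N" "closed S"
  proof -
    let ?A = "{(x, x) | x. x \<in> M}"
    have "csubspace ?A"
      using assms(2) by (auto simp: complex_vector.subspace_def scaleC_prod_def zero_prod_def)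
    moreover have "?A = fst -` M \<inter> {p. fst p = snd p}"
      by auto
    then have "closed ?A"
      using cl by (auto intro!: closed_Int closed_vimage closed_Collect_eq continuous_intros)
    \<comment> \<open>The criterion for closed sums is applied in the product Hilbert space.\<close>
    ultimately have "closed (?A + N \<times> S) \<longleftrightarrow>
        closed (orthogonal_complement ?A + orthogonal_complement (N \<times> S))"
      by (intro closed_sum_iff_closed_sum_orthogonal_complement csubspace_Times closed_Times
          assms(3,4) cl)
    then show ?thesis
      unfolding assms(6) P3_eq_graph_plus_Times
        orthogonal_complement_graph_plus_Times[OF assms(3,4)] closed_vimage_add_iff .
  qed
  ultimately show ?thesis
    by blast
qed

end
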